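(* Let $A$ be a group which contains a subgroup $H$ of finite index such that $H$ is equationally Artinian. Then $A$ is also equationally Artinian.
   Context: For a group $G$ and a finite set of variables $X=\{x_1,\dots,x_n\}$, let $G[X]=G\ast F[X]$ be the free product of $G$ with the free group $F[X]$ on $X$. An element $w\in G[X]$ is regarded as an equation $w\approx 1$ with coefficients from $G$; a tuple $\overline{h}=(h_1,\dots,h_n)\in G^n$ is a root of it if substituting $h_i$ for $x_i$ gives $w(\overline{h})=1$ in $G$. A system of equations is an arbitrary subset $S\subseteq G[X]$, and its algebraic set $V_G(S)\subseteq G^n$ is the set of all common roots in $G^n$ of the elements of $S$. A subset of $G^n$ is an algebraic set if it is of the form $V_G(S)$ for some $S\subseteq G[X]$. A group $G$ is called equationally Artinian if for every natural number $n$, every ascending chain $Y_1\subseteq Y_2\subseteq\cdots$ of algebraic sets in $G^n$ terminates (i.e. is eventually constant). Here all elements of the group itself are allowed as coefficients (the "Diophantine" case). *)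

theory Defs
  imports "HOL-Algebra.Coset"
begin

inductive word_cong :: "'l set \<Rightarrow> ('l list \<Rightarrow> 'l list \<Rightarrow> bool) \<Rightarrow> 'l list \<Rightarrow> 'l list \<Rightarrow> bool"
  for L :: "'l set" and R :: "'l list \<Rightarrow> 'l list \<Rightarrow> bool" where
  refl: "w \<in> lists L \<Longrightarrow> word_cong L R w w"
| step: "R u v \<Longrightarrow> p @ u @ q \<in> lists L \<Longrightarrow> p @ v @ q \<in> lists L
    \<Longrightarrow> word_cong L R (p @ u @ q) (p @ v @ q)"
| sym: "word_cong L R u v \<Longrightarrow> word_cong L R v u"
| trans: "word_cong L R u v \<Longrightarrow> word_cong L R v w \<Longrightarrow> word_cong L R u w"

definition word_class :: "'l set \<Rightarrow> ('l list \<Rightarrow> 'l list \<Rightarrow> bool) \<Rightarrow> 'l list \<Rightarrow> 'l list set" where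
  "word_class L R w = {v. word_cong L R w v}"

text \<open>The monoid presented by the letters \<open>L\<close> and the relations \<open>u = v\<close> for \<open>R u v\<close>
  (only relations between words over \<open>L\<close> count). Its elements are congruence classes of words.\<close>

definition word_quotient :: "'l set \<Rightarrow> ('l list \<Rightarrow> 'l list \<Rightarrow> bool) \<Rightarrow> 'l list set monoid" where
  "word_quotient L R =
    \<lparr>carrier = word_class L R ` lists L,
     mult = (\<lambda>C D. \<Union>u\<in>C. \<Union>v\<in>D. word_class L R (u @ v)),
     one = word_class L R []\<rparr>"

text \<open>The letter \<open>(x, True)\<close> stands for \<open>x\<close> and \<open>(x, False)\<close> for its inverse.\<close>

inductive free_group_rel :: "('x \<times> bool) list \<Rightarrow> ('x \<times> bool) list \<Rightarrow> bool" where
  "free_group_rel [(x, b), (x, \<not> b)] []"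

definition free_group :: "'x set \<Rightarrow> ('x \<times> bool) list set monoid" where
  "free_group X = word_quotient (X \<times> UNIV) free_group_rel"

inductive free_product_rel ::
  "('a, 'c) monoid_scheme \<Rightarrow> ('b, 'd) monoid_scheme \<Rightarrow> ('a + 'b) list \<Rightarrow> ('a + 'b) list \<Rightarrow> bool"
  for G :: "('a, 'c) monoid_scheme" and K :: "('b, 'd) monoid_scheme" where
  "free_product_rel G K [Inl g, Inl g'] [Inl (g \<otimes>\<^bsub>G\<^esub> g')]"
| "free_product_rel G K [Inl \<one>\<^bsub>G\<^esub>] []"
| "free_product_rel G K [Inr k, Inr k'] [Inr (k \<otimes>\<^bsub>K\<^esub> k')]"
| "free_product_rel G K [Inr \<one>\<^bsub>K\<^esub>] []"

definition free_product ::
  "('a, 'c) monoid_scheme \<Rightarrow> ('b, 'd) monoid_scheme \<Rightarrow> ('a + 'b) list set monoid" where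
  "free_product G K = word_quotient (carrier G <+> carrier K) (free_product_rel G K)"

definition word_eval :: "('m, 'c) monoid_scheme \<Rightarrow> ('l \<Rightarrow> 'm) \<Rightarrow> 'l list \<Rightarrow> 'm" where
  "word_eval M f w = foldr (\<lambda>l m. f l \<otimes>\<^bsub>M\<^esub> m) w \<one>\<^bsub>M\<^esub>"

text \<open>The homomorphism out of a \<^const>\<open>word_quotient\<close> given on letters by \<open>f\<close>. It is meaningful
  only if \<open>f\<close> respects the relations, so that evaluation is constant on each class;
  see \<open>word_lift_class\<close>.\<close>

definition word_lift :: "('m, 'c) monoid_scheme \<Rightarrow> ('l \<Rightarrow> 'm) \<Rightarrow> 'l list set \<Rightarrow> 'm" where
  "word_lift M f C = the_elem (word_eval M f ` C)"

definition free_group_lift ::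
  "('m, 'c) monoid_scheme \<Rightarrow> ('x \<Rightarrow> 'm) \<Rightarrow> ('x \<times> bool) list set \<Rightarrow> 'm" where
  "free_group_lift M h = word_lift M (\<lambda>(x, b). if b then h x else inv\<^bsub>M\<^esub> (h x))"

definition free_product_lift ::
  "('m, 'c) monoid_scheme \<Rightarrow> ('a \<Rightarrow> 'm) \<Rightarrow> ('b \<Rightarrow> 'm) \<Rightarrow> ('a + 'b) list set \<Rightarrow> 'm" where
  "free_product_lift M f g = word_lift M (case_sum f g)"

text \<open>The variables \<open>x\<^sub>1, \<dots>, x\<^sub>n\<close> are represented by the indices \<open>0, \<dots>, n - 1\<close>.\<close>

type_synonym 'a equation = "('a + (nat \<times> bool) list set) list set"

definition equation_group :: "('a, 'c) monoid_scheme \<Rightarrow> nat \<Rightarrow> 'a equation monoid" where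
  "equation_group G n = free_product G (free_group {..<n})"

definition tuples :: "('a, 'c) monoid_scheme \<Rightarrow> nat \<Rightarrow> (nat \<Rightarrow> 'a) set" where
  "tuples G n = {..<n} \<rightarrow>\<^sub>E carrier G"

definition substitute :: "('a, 'c) monoid_scheme \<Rightarrow> (nat \<Rightarrow> 'a) \<Rightarrow> 'a equation \<Rightarrow> 'a" where
  "substitute G h = free_product_lift G (\<lambda>g. g) (free_group_lift G h)"

definition roots :: "('a, 'c) monoid_scheme \<Rightarrow> nat \<Rightarrow> 'a equation set \<Rightarrow> (nat \<Rightarrow> 'a) set" where
  "roots G n S = {h \<in> tuples G n. \<forall>w\<in>S. substitute G h w = \<one>\<^bsub>G\<^esub>}"

definition algebraic_set :: "('a, 'c) monoid_scheme \<Rightarrow> nat \<Rightarrow> (nat \<Rightarrow> 'a) set \<Rightarrow> bool" where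
  "algebraic_set G n Y \<longleftrightarrow> (\<exists>S \<subseteq> carrier (equation_group G n). Y = roots G n S)"

definition equationally_Artinian :: "('a, 'c) monoid_scheme \<Rightarrow> bool" where
  "equationally_Artinian G \<longleftrightarrow>
    (\<forall>n. \<forall>Y :: nat \<Rightarrow> (nat \<Rightarrow> 'a) set.
      (\<forall>i. algebraic_set G n (Y i)) \<longrightarrow> (\<forall>i. Y i \<subseteq> Y (Suc i)) \<longrightarrow>
      (\<exists>m. \<forall>i\<ge>m. Y i = Y m))"


subsection \<open>The constructions are groups and the lifts are homomorphisms\<close>

lemma word_cong_lists:
  "word_cong L R u v \<Longrightarrow> u \<in> lists L \<and> v \<in> lists L"
  by (induction rule: word_cong.induct) auto

lemma word_class_eq_iff:
  assumes "u \<in> lists L"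
  shows "word_class L R u = word_class L R v \<longleftrightarrow> word_cong L R u v"
proof
  assume "word_class L R u = word_class L R v"
  then have "word_cong L R v u"
    using word_cong.refl[OF assms, of R] by (auto simp: word_class_def)
  then show "word_cong L R u v"
    by (rule word_cong.sym)
next
  assume "word_cong L R u v"
  then have "word_cong L R u w \<longleftrightarrow> word_cong L R v w" for w
    using word_cong.sym word_cong.trans by metis
  then show "word_class L R u = word_class L R v"
    by (simp add: word_class_def)
qed

lemma word_cong_append_right:
  "word_cong L R u v \<Longrightarrow> w \<in> lists L \<Longrightarrow> word_cong L R (u @ w) (v @ w)"
proof (induction rule: word_cong.induct)
  case (step u v p q)
  then show ?case
    using word_cong.step[of R u v p "q @ w" L] by simp
next
  case (refl u)
  then show ?case
    by (intro word_cong.refl) simp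
next
  case (sym u v)
  show ?case
    by (rule word_cong.sym[OF sym.IH[OF sym.prems]])
next
  case (trans u v z)
  show ?case
    by (rule word_cong.trans[OF trans.IH(1)[OF trans.prems] trans.IH(2)[OF trans.prems]])
qed

lemma word_cong_append_left:
  "word_cong L R u v \<Longrightarrow> w \<in> lists L \<Longrightarrow> word_cong L R (w @ u) (w @ v)"
proof (induction rule: word_cong.induct)
  case (step u v p q)
  then show ?case
    using word_cong.step[of R u v "w @ p" q L] by simp
next
  case (refl u)
  then show ?case
    by (intro word_cong.refl) simp
next
  case (sym u v)
  show ?case
    by (rule word_cong.sym[OF sym.IH[OF sym.prems]])
next
  case (trans u v z)
  show ?case
    by (rule word_cong.trans[OF trans.IH(1)[OF trans.prems] trans.IH(2)[OF trans.prems]])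
qed

lemma word_cong_append:
  assumes "word_cong L R u u'" "word_cong L R v v'"
  shows "word_cong L R (u @ v) (u' @ v')"
proof (rule word_cong.trans)
  show "word_cong L R (u @ v) (u' @ v)"
    by (rule word_cong_append_right) (use assms word_cong_lists in blast)+
  show "word_cong L R (u' @ v) (u' @ v')"
    by (rule word_cong_append_left) (use assms word_cong_lists in blast)+
qed

lemma word_quotient_mult:
  assumes "u \<in> lists L" "v \<in> lists L"
  shows "word_class L R u \<otimes>\<^bsub>word_quotient L R\<^esub> word_class L R v = word_class L R (u @ v)"
proof -
  have *: "word_class L R (u' @ v') = word_class L R (u @ v)"
    if "u' \<in> word_class L R u" "v' \<in> word_class L R v" for u' v'
  proof -
    have "word_cong L R (u @ v) (u' @ v')"
      using that by (simp add: word_class_def word_cong_append)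
    moreover have "u @ v \<in> lists L"
      using assms by simp
    ultimately show ?thesis
      by (metis word_class_eq_iff)
  qed
  have ne: "word_class L R u \<noteq> {}" "word_class L R v \<noteq> {}"
    using assms[THEN word_cong.refl] by (auto simp: word_class_def)
  have "word_class L R u \<otimes>\<^bsub>word_quotient L R\<^esub> word_class L R v =
      (\<Union>u'\<in>word_class L R u. \<Union>v'\<in>word_class L R v. word_class L R (u' @ v'))"
    by (simp add: word_quotient_def)
  also have "\<dots> = (\<Union>u'\<in>word_class L R u. \<Union>v'\<in>word_class L R v. word_class L R (u @ v))"
    by (intro SUP_cong HOL.refl *)
  also have "\<dots> = word_class L R (u @ v)"
    using ne by simp
  finally show ?thesis .
qed

lemma word_quotient_group:
  assumes inv: "\<And>l. l \<in> L \<Longrightarrow> \<exists>l'\<in>L. word_cong L R [l', l] []"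
  shows "group (word_quotient L R)"
proof -
  have carrier: "carrier (word_quotient L R) = word_class L R ` lists L"
    and one: "\<one>\<^bsub>word_quotient L R\<^esub> = word_class L R []"
    by (simp_all add: word_quotient_def)
  have *: "\<exists>v\<in>lists L. word_cong L R (v @ w) []" if "w \<in> lists L" for w
    using that
  proof (induction w)
    case Nil
    then show ?case by (auto intro: word_cong.refl)
  next
    case (Cons l w)
    then obtain v where v: "v \<in> lists L" "word_cong L R (v @ w) []"
      by auto
    obtain l' where l': "l' \<in> L" "word_cong L R [l', l] []"
      using inv[of l] Cons.hyps by blast
    have "word_cong L R (v @ [l', l] @ w) (v @ [] @ w)"
      by (intro word_cong_append_left word_cong_append_right l'(2)) (use v(1) Cons.hyps in auto)
    then have "word_cong L R ((v @ [l']) @ l # w) []"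
      using word_cong.trans[OF _ v(2)] by simp
    then show ?case
      using v(1) l'(1) by (intro bexI[of _ "v @ [l']"]) auto
  qed
  show ?thesis
  proof (rule groupI)
    fix x assume "x \<in> carrier (word_quotient L R)"
    then obtain w where w: "w \<in> lists L" "x = word_class L R w"
      by (auto simp: carrier)
    then obtain v where v: "v \<in> lists L" "word_cong L R (v @ w) []"
      using * by blast
    have "word_class L R v \<otimes>\<^bsub>word_quotient L R\<^esub> x = \<one>\<^bsub>word_quotient L R\<^esub>"
      using v w by (simp add: word_quotient_mult one word_class_eq_iff)
    then show "\<exists>y\<in>carrier (word_quotient L R). y \<otimes>\<^bsub>word_quotient L R\<^esub> x = \<one>\<^bsub>word_quotient L R\<^esub>"
      using v(1) carrier by blast
  next
    fix x y assume "x \<in> carrier (word_quotient L R)" "y \<in> carrier (word_quotient L R)"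
    then obtain u v where "u \<in> lists L" "v \<in> lists L" "x = word_class L R u" "y = word_class L R v"
      by (auto simp: carrier)
    then show "x \<otimes>\<^bsub>word_quotient L R\<^esub> y \<in> carrier (word_quotient L R)"
      unfolding carrier by (intro image_eqI[of _ _ "u @ v"]) (simp_all add: word_quotient_mult)
  next
    fix x y z
    assume "x \<in> carrier (word_quotient L R)" "y \<in> carrier (word_quotient L R)"
      "z \<in> carrier (word_quotient L R)"
    then obtain u v w where "u \<in> lists L" "v \<in> lists L" "w \<in> lists L"
      "x = word_class L R u" "y = word_class L R v" "z = word_class L R w"
      by (auto simp: carrier)
    then show "x \<otimes>\<^bsub>word_quotient L R\<^esub> y \<otimes>\<^bsub>word_quotient L R\<^esub> z =
        x \<otimes>\<^bsub>word_quotient L R\<^esub> (y \<otimes>\<^bsub>word_quotient L R\<^esub> z)"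
      by (simp add: word_quotient_mult)
  next
    show "\<one>\<^bsub>word_quotient L R\<^esub> \<in> carrier (word_quotient L R)"
      by (simp add: carrier one)
  next
    fix x assume "x \<in> carrier (word_quotient L R)"
    then obtain w where "w \<in> lists L" "x = word_class L R w"
      by (auto simp: carrier)
    then show "\<one>\<^bsub>word_quotient L R\<^esub> \<otimes>\<^bsub>word_quotient L R\<^esub> x = x"
      by (simp add: one word_quotient_mult)
  qed
qed

lemma (in monoid) word_eval_closed:
  assumes "f \<in> L \<rightarrow> carrier G" "w \<in> lists L"
  shows "word_eval G f w \<in> carrier G"
  using assms(2) by (induction w) (use assms(1) in \<open>auto simp: word_eval_def\<close>)

lemma (in monoid) word_eval_append:
  assumes "f \<in> L \<rightarrow> carrier G" "u \<in> lists L" "v \<in> lists L"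
  shows "word_eval G f (u @ v) = word_eval G f u \<otimes> word_eval G f v"
  using assms(2)
proof (induction u)
  case Nil
  then show ?case
    using word_eval_closed[OF assms(1,3)] by (simp add: word_eval_def)
next
  case (Cons l u)
  moreover have "f l \<in> carrier G"
    using Cons.hyps assms(1) by blast
  ultimately show ?case
    using word_eval_closed[OF assms(1), of u] word_eval_closed[OF assms(1,3)]
    by (simp add: word_eval_def m_assoc)
qed

lemma (in monoid) word_eval_cong:
  assumes f: "f \<in> L \<rightarrow> carrier G"
    and R: "\<And>u v. R u v \<Longrightarrow> u \<in> lists L \<Longrightarrow> v \<in> lists L \<Longrightarrow> word_eval G f u = word_eval G f v"
    and "word_cong L R u v"
  shows "word_eval G f u = word_eval G f v"
  using assms(3)
proof (induction rule: word_cong.induct)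
  case (step u v p q)
  then show ?case
    using R[of u v] by (simp add: word_eval_append[OF f])
qed auto

lemma (in monoid) word_lift_class:
  assumes f: "f \<in> L \<rightarrow> carrier G"
    and R: "\<And>u v. R u v \<Longrightarrow> u \<in> lists L \<Longrightarrow> v \<in> lists L \<Longrightarrow> word_eval G f u = word_eval G f v"
    and w: "w \<in> lists L"
  shows "word_lift G f (word_class L R w) = word_eval G f w"
proof -
  have "word_eval G f ` word_class L R w = {word_eval G f w}"
  proof (intro equalityI subsetI)
    fix a assume "a \<in> word_eval G f ` word_class L R w"
    then obtain v where v: "a = word_eval G f v" "word_cong L R w v"
      by (auto simp: word_class_def)
    have "word_eval G f w = word_eval G f v"
      by (rule word_eval_cong[OF f _ v(2)]) (rule R)
    then show "a \<in> {word_eval G f w}"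
      using v(1) by simp
  next
    fix a assume "a \<in> {word_eval G f w}"
    then show "a \<in> word_eval G f ` word_class L R w"
      using word_cong.refl[OF w, of R] by (auto simp: word_class_def)
  qed
  then show ?thesis
    by (simp add: word_lift_def)
qed

lemma (in monoid) word_lift_hom:
  assumes f: "f \<in> L \<rightarrow> carrier G"
    and R: "\<And>u v. R u v \<Longrightarrow> u \<in> lists L \<Longrightarrow> v \<in> lists L \<Longrightarrow> word_eval G f u = word_eval G f v"
  shows "word_lift G f \<in> hom (word_quotient L R) G"
proof (rule homI)
  have carrier: "carrier (word_quotient L R) = word_class L R ` lists L"
    by (simp add: word_quotient_def)
  show "word_lift G f x \<in> carrier G" if x: "x \<in> carrier (word_quotient L R)" for x
  proof -
    obtain w where w: "w \<in> lists L" "x = word_class L R w"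
      using x by (auto simp: carrier)
    have "word_lift G f x = word_eval G f w"
      unfolding w(2) by (rule word_lift_class[OF f _ w(1)]) (rule R)
    then show ?thesis
      using word_eval_closed[OF f w(1)] by simp
  qed
  show "word_lift G f (x \<otimes>\<^bsub>word_quotient L R\<^esub> y) = word_lift G f x \<otimes> word_lift G f y"
    if xy: "x \<in> carrier (word_quotient L R)" "y \<in> carrier (word_quotient L R)" for x y
  proof -
    obtain u v where uv: "u \<in> lists L" "v \<in> lists L"
      and eq: "x = word_class L R u" "y = word_class L R v"
      using xy by (auto simp: carrier)
    have lift: "word_lift G f (word_class L R w) = word_eval G f w" if "w \<in> lists L" for w
      by (rule word_lift_class[OF f _ that]) (rule R)
    have "word_lift G f (word_class L R (u @ v)) = word_eval G f (u @ v)"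
      by (rule lift) (use uv in simp)
    then show ?thesis
      using word_eval_append[OF f uv]
      by (simp only: eq word_quotient_mult[OF uv] lift[OF uv(1)] lift[OF uv(2)])
  qed
qed

lemma free_group_group: "group (free_group X)"
  unfolding free_group_def
proof (rule word_quotient_group)
  fix l assume "l \<in> X \<times> (UNIV :: bool set)"
  then obtain x b where l: "l = (x, b)" "x \<in> X" by blast
  have "word_cong (X \<times> UNIV) free_group_rel ([] @ [(x, \<not> b), (x, \<not> \<not> b)] @ []) ([] @ [] @ [])"
    by (rule word_cong.step) (use l in \<open>auto intro: free_group_rel.intros simp del: not_not\<close>)
  then show "\<exists>l'\<in>X \<times> UNIV. word_cong (X \<times> UNIV) free_group_rel [l', l] []"
    using l by (intro bexI[of _ "(x, \<not> b)"]) auto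
qed

lemma free_product_group:
  assumes "group G" "group K"
  shows "group (free_product G K)"
  unfolding free_product_def
proof (rule word_quotient_group)
  interpret G: group G by fact
  interpret K: group K by fact
  let ?L = "carrier G <+> carrier K"
  let ?R = "free_product_rel G K"
  fix l assume "l \<in> ?L"
  then consider g where "l = Inl g" "g \<in> carrier G" | k where "l = Inr k" "k \<in> carrier K"
    by blast
  then show "\<exists>l'\<in>?L. word_cong ?L ?R [l', l] []"
  proof cases
    case 1
    have "?R [Inl (inv\<^bsub>G\<^esub> g), Inl g] [Inl \<one>\<^bsub>G\<^esub>]"
      using free_product_rel.intros(1)[of G K "inv\<^bsub>G\<^esub> g" g] 1 by simp
    then have "word_cong ?L ?R ([] @ [Inl (inv\<^bsub>G\<^esub> g), Inl g] @ []) ([] @ [Inl \<one>\<^bsub>G\<^esub>] @ [])"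
      by (rule word_cong.step) (use 1 in auto)
    moreover have "word_cong ?L ?R ([] @ [Inl \<one>\<^bsub>G\<^esub>] @ []) ([] @ [] @ [])"
      by (rule word_cong.step) (auto intro: free_product_rel.intros)
    ultimately have "word_cong ?L ?R [Inl (inv\<^bsub>G\<^esub> g), l] []"
      using 1 by (auto intro: word_cong.trans)
    then show ?thesis
      using 1 by (intro bexI[of _ "Inl (inv\<^bsub>G\<^esub> g)"]) auto
  next
    case 2
    have "?R [Inr (inv\<^bsub>K\<^esub> k), Inr k] [Inr \<one>\<^bsub>K\<^esub>]"
      using free_product_rel.intros(3)[of G K "inv\<^bsub>K\<^esub> k" k] 2 by simp
    then have "word_cong ?L ?R ([] @ [Inr (inv\<^bsub>K\<^esub> k), Inr k] @ []) ([] @ [Inr \<one>\<^bsub>K\<^esub>] @ [])"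
      by (rule word_cong.step) (use 2 in auto)
    moreover have "word_cong ?L ?R ([] @ [Inr \<one>\<^bsub>K\<^esub>] @ []) ([] @ [] @ [])"
      by (rule word_cong.step) (auto intro: free_product_rel.intros)
    ultimately have "word_cong ?L ?R [Inr (inv\<^bsub>K\<^esub> k), l] []"
      using 2 by (auto intro: word_cong.trans)
    then show ?thesis
      using 2 by (intro bexI[of _ "Inr (inv\<^bsub>K\<^esub> k)"]) auto
  qed
qed

lemma equation_group_group: "group G \<Longrightarrow> group (equation_group G n)"
  by (simp add: equation_group_def free_product_group free_group_group)

definition coefficient :: "('a, 'c) monoid_scheme \<Rightarrow> nat \<Rightarrow> 'a \<Rightarrow> 'a equation" where
  "coefficient G n g =
    word_class (carrier G <+> carrier (free_group {..<n})) (free_product_rel G (free_group {..<n}))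
      [Inl g]"

definition variable :: "('a, 'c) monoid_scheme \<Rightarrow> nat \<Rightarrow> nat \<Rightarrow> 'a equation" where
  "variable G n i =
    word_class (carrier G <+> carrier (free_group {..<n})) (free_product_rel G (free_group {..<n}))
      [Inr (word_class ({..<n} \<times> UNIV) free_group_rel [(i, True)])]"

context group
begin

lemma free_group_letter_eval:
  fixes h :: "'x \<Rightarrow> 'a"
  defines "f \<equiv> \<lambda>(x, b). if b then h x else inv (h x)"
  assumes "h \<in> X \<rightarrow> carrier G"
  shows "f \<in> X \<times> UNIV \<rightarrow> carrier G"
    and "free_group_rel u v \<Longrightarrow> u \<in> lists (X \<times> UNIV) \<Longrightarrow> v \<in> lists (X \<times> UNIV)
      \<Longrightarrow> word_eval G f u = word_eval G f v"
  using assms by (auto simp: word_eval_def Pi_iff elim!: free_group_rel.cases)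

lemma free_group_lift_hom:
  assumes "h \<in> X \<rightarrow> carrier G"
  shows "free_group_lift G h \<in> hom (free_group X) G"
  unfolding free_group_lift_def free_group_def
  by (rule word_lift_hom) (use free_group_letter_eval[OF assms] in blast)+

lemma free_group_lift_var:
  assumes "h \<in> X \<rightarrow> carrier G" "x \<in> X"
  shows "free_group_lift G h (word_class (X \<times> UNIV) free_group_rel [(x, True)]) = h x"
  unfolding free_group_lift_def
  by (subst word_lift_class[OF free_group_letter_eval[OF assms(1)]])
    (use assms in \<open>auto simp: word_eval_def Pi_iff\<close>)

lemma free_product_letter_eval:
  assumes "group H" "group K" "f \<in> hom H G" "g \<in> hom K G"
  shows "case_sum f g \<in> carrier H <+> carrier K \<rightarrow> carrier G"
    and "free_product_rel H K u v \<Longrightarrow> u \<in> lists (carrier H <+> carrier K)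
      \<Longrightarrow> v \<in> lists (carrier H <+> carrier K)
      \<Longrightarrow> word_eval G (case_sum f g) u = word_eval G (case_sum f g) v"
proof -
  have one: "f \<one>\<^bsub>H\<^esub> = \<one>" "g \<one>\<^bsub>K\<^esub> = \<one>"
    using assms by (auto intro: hom_one is_group)
  have closed: "\<And>a. a \<in> carrier H \<Longrightarrow> f a \<in> carrier G" "\<And>b. b \<in> carrier K \<Longrightarrow> g b \<in> carrier G"
    using assms by (auto simp: hom_def)
  have mult: "\<And>a a'. a \<in> carrier H \<Longrightarrow> a' \<in> carrier H \<Longrightarrow> f (a \<otimes>\<^bsub>H\<^esub> a') = f a \<otimes> f a'"
    "\<And>b b'. b \<in> carrier K \<Longrightarrow> b' \<in> carrier K \<Longrightarrow> g (b \<otimes>\<^bsub>K\<^esub> b') = g b \<otimes> g b'"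
    using assms by (auto simp: hom_def)
  show "case_sum f g \<in> carrier H <+> carrier K \<rightarrow> carrier G"
    using closed by auto
  show "word_eval G (case_sum f g) u = word_eval G (case_sum f g) v"
    if "free_product_rel H K u v" "u \<in> lists (carrier H <+> carrier K)"
      "v \<in> lists (carrier H <+> carrier K)"
    using that
    by cases (auto simp: word_eval_def one closed mult)
qed

lemma free_product_lift_hom:
  assumes "group H" "group K" "f \<in> hom H G" "g \<in> hom K G"
  shows "free_product_lift G f g \<in> hom (free_product H K) G"
  unfolding free_product_lift_def free_product_def
  by (rule word_lift_hom) (use free_product_letter_eval[OF assms] in blast)+

lemma free_product_lift_letter:
  assumes "group H" "group K" "f \<in> hom H G" "g \<in> hom K G" "l \<in> carrier H <+> carrier K"
  shows "free_product_lift G f g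
      (word_class (carrier H <+> carrier K) (free_product_rel H K) [l]) = case_sum f g l"
  unfolding free_product_lift_def
  by (subst word_lift_class[OF free_product_letter_eval[OF assms(1-4)]])
    (use assms free_product_letter_eval(1)[OF assms(1-4)] in \<open>auto simp: word_eval_def hom_def Pi_iff\<close>)

lemma substitute_hom:
  assumes "h \<in> tuples G n"
  shows "substitute G h \<in> hom (equation_group G n) G"
  unfolding substitute_def equation_group_def
  by (intro free_product_lift_hom is_group free_group_group free_group_lift_hom)
    (use assms in \<open>auto simp: hom_def tuples_def\<close>)

lemma substitute_coefficient:
  assumes "h \<in> tuples G n" "g \<in> carrier G"
  shows "substitute G h (coefficient G n g) = g"
proof -
  have h: "h \<in> {..<n} \<rightarrow> carrier G"
    using assms(1) by (auto simp: tuples_def)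
  have "(\<lambda>a. a) \<in> hom G G"
    by (simp add: hom_def)
  from free_product_lift_letter[OF is_group free_group_group this free_group_lift_hom[OF h],
      of "Inl g"] assms(2)
  show ?thesis
    by (simp add: substitute_def coefficient_def InlI)
qed

lemma substitute_variable:
  assumes "h \<in> tuples G n" "i < n"
  shows "substitute G h (variable G n i) = h i"
proof -
  let ?x = "word_class ({..<n} \<times> UNIV) free_group_rel [(i, True)]"
  have h: "h \<in> {..<n} \<rightarrow> carrier G"
    using assms(1) by (auto simp: tuples_def)
  have id: "(\<lambda>a. a) \<in> hom G G"
    by (simp add: hom_def)
  have "?x \<in> carrier (free_group {..<n})"
    using assms(2) by (auto simp: free_group_def word_quotient_def)
  with free_product_lift_letter[OF is_group free_group_group id free_group_lift_hom[OF h],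
      of "Inr ?x"] free_group_lift_var[OF h, of i] assms(2)
  show ?thesis
    by (simp add: substitute_def variable_def InrI)
qed

end

end

theory Submission
  imports Defs
begin

text \<open>
  Let \<open>H\<close> have finite index in \<open>A\<close> and choose a representative \<open>t\<^sub>C\<close> of every right coset \<open>C\<close> of
  \<open>H\<close>. Right multiplication by \<open>a \<in> A\<close> permutes the cosets, and \<open>t\<^sub>C a = c(C, a) t\<^bsub>Ca\<^esub>\<close> for a unique
  \<open>c(C, a) \<in> H\<close>. Hence a tuple \<open>h \<in> A\<^sup>n\<close> is described by two pieces of data: the permutations of
  the cosets induced by its entries, of which there are only finitely many possibilities, and the
  tuple \<open>\<phi>(h)\<close> of all the elements \<open>c(C, h\<^sub>i)\<close> of \<open>H\<close>, of length \<open>N = n |A : H|\<close>. This is the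
  embedding of \<open>A\<close> into the wreath product of \<open>H\<close> with a finite symmetric group; it makes passing
  to a normal subgroup of finite index unnecessary.

  The main point (\<open>equation_over_subgroup\<close>) is that on a set of tuples that induce the same
  permutations, every equation \<open>w\<close> over \<open>A\<close> in \<open>n\<close> variables becomes an equation over \<open>H\<close> in
  \<open>N\<close> variables: for each coset \<open>C\<close> there are a coset \<open>D\<close> and \<open>u \<in> H[X\<^sub>N]\<close> with
  \<open>t\<^sub>C w(h) = u(\<phi>(h)) t\<^sub>D\<close> for all these tuples \<open>h\<close>. In this form the statement is visibly stable
  under products of equations, so it needs to be checked on coefficients, variables and inverses of
  variables only.

  Chains of algebraic sets are awkward to transport along \<open>\<phi>\<close>, whose image need not be
  algebraic. By the Galois correspondence between sets of points and sets of equations, however,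
  a group is equationally Artinian if and only if, along every ascending chain of \<^emph>\<open>arbitrary\<close>
  sets of points, the equations that vanish on them are eventually constant
  (\<open>equationally_Artinian_iff_vanishing\<close>). An ascending chain in \<open>A\<^sup>n\<close> is cut into finitely many
  pieces according to the induced permutations; each piece is mapped by \<open>\<phi>\<close> to an ascending chain
  in \<open>H\<^sup>N\<close>, and stability of the latter is pulled back through \<open>u\<close>.
\<close>

section \<open>Vanishing equations of ascending chains\<close>

definition vanishing_equations ::
  "('a, 'c) monoid_scheme \<Rightarrow> nat \<Rightarrow> (nat \<Rightarrow> 'a) set \<Rightarrow> 'a equation set" where
  "vanishing_equations G n X =
    {w \<in> carrier (equation_group G n). \<forall>h\<in>X. substitute G h w = \<one>\<^bsub>G\<^esub>}"

lemma vanishing_equations_antimono: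
  "X \<subseteq> Y \<Longrightarrow> vanishing_equations G n Y \<subseteq> vanishing_equations G n X"
  by (auto simp: vanishing_equations_def)

lemma roots_vanishing_equations_algebraic:
  assumes "algebraic_set G n Y"
  shows "roots G n (vanishing_equations G n Y) = Y"
  using assms unfolding algebraic_set_def roots_def vanishing_equations_def by blast

lemma vanishing_equations_closure:
  assumes "X \<subseteq> tuples G n"
  shows "vanishing_equations G n (roots G n (vanishing_equations G n X)) = vanishing_equations G n X"
  using assms unfolding roots_def vanishing_equations_def by blast

text \<open>An algebraic set is determined by its vanishing equations, and any set of points has the same
  vanishing equations as the least algebraic set that contains it. So chains of algebraic sets may
  be replaced by chains of arbitrary sets if only the vanishing equations are observed.\<close>

lemma equationally_Artinian_iff_vanishing:
  "equationally_Artinian G \<longleftrightarrow>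
    (\<forall>n X. (\<forall>i. X i \<subseteq> tuples G n) \<longrightarrow> (\<forall>i. X i \<subseteq> X (Suc i)) \<longrightarrow>
      (\<exists>m. \<forall>i\<ge>m. vanishing_equations G n (X i) = vanishing_equations G n (X m)))"
  (is "_ \<longleftrightarrow> ?R")
proof
  assume art: "equationally_Artinian G"
  show ?R
  proof (intro allI impI)
    fix n and X :: "nat \<Rightarrow> (nat \<Rightarrow> 'a) set"
    assume X: "\<forall>i. X i \<subseteq> tuples G n" and asc: "\<forall>i. X i \<subseteq> X (Suc i)"
    define Y where "Y i = roots G n (vanishing_equations G n (X i))" for i
    have "algebraic_set G n (Y i)" for i
      unfolding algebraic_set_def Y_def
      by (rule exI[of _ "vanishing_equations G n (X i)"]) (simp add: vanishing_equations_def)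
    moreover have "Y i \<subseteq> Y (Suc i)" for i
      using vanishing_equations_antimono[OF asc[THEN spec[of _ i]], of G n]
      by (auto simp: Y_def roots_def)
    ultimately obtain m where "\<forall>i\<ge>m. Y i = Y m"
      using art[unfolded equationally_Artinian_def, THEN spec[of _ n], THEN spec[of _ Y]] by blast
    moreover have "vanishing_equations G n (Y i) = vanishing_equations G n (X i)" for i
      unfolding Y_def using X by (intro vanishing_equations_closure) simp
    ultimately have "\<forall>i\<ge>m. vanishing_equations G n (X i) = vanishing_equations G n (X m)"
      by metis
    then show "\<exists>m. \<forall>i\<ge>m. vanishing_equations G n (X i) = vanishing_equations G n (X m)" ..
  qed
next
  assume R: ?R
  show "equationally_Artinian G"
    unfolding equationally_Artinian_def
  proof (intro allI impI)
    fix n and Y :: "nat \<Rightarrow> (nat \<Rightarrow> 'a) set"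
    assume alg: "\<forall>i. algebraic_set G n (Y i)" and asc: "\<forall>i. Y i \<subseteq> Y (Suc i)"
    have "Y i \<subseteq> tuples G n" for i
      using alg[THEN spec[of _ i]] unfolding algebraic_set_def roots_def by auto
    then obtain m where "\<forall>i\<ge>m. vanishing_equations G n (Y i) = vanishing_equations G n (Y m)"
      using R[THEN spec[of _ n], THEN spec[of _ Y]] asc by blast
    moreover have "roots G n (vanishing_equations G n (Y i)) = Y i" for i
      using alg by (intro roots_vanishing_equations_algebraic) simp
    ultimately have "\<forall>i\<ge>m. Y i = Y m"
      by metis
    then show "\<exists>m. \<forall>i\<ge>m. Y i = Y m" ..
  qed
qed


section \<open>Induction on equations\<close>

lemma word_quotient_induct [consumes 1, case_names one letter]:
  assumes "x \<in> carrier (word_quotient L R)"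
    and "P \<one>\<^bsub>word_quotient L R\<^esub>"
    and letter: "\<And>l y. l \<in> L \<Longrightarrow> y \<in> carrier (word_quotient L R) \<Longrightarrow> P y
      \<Longrightarrow> P (word_class L R [l] \<otimes>\<^bsub>word_quotient L R\<^esub> y)"
  shows "P x"
proof -
  have carrier: "carrier (word_quotient L R) = word_class L R ` lists L"
    by (simp add: word_quotient_def)
  obtain w where w: "w \<in> lists L" "x = word_class L R w"
    using assms(1) by (auto simp: carrier)
  from w(1) have "P (word_class L R w)"
  proof (induction w)
    case Nil
    then show ?case
      using assms(2) by (simp add: word_quotient_def)
  next
    case (Cons l w)
    then have "word_class L R w \<in> carrier (word_quotient L R)"
      by (auto simp: carrier)
    from letter[OF Cons.hyps(1) this Cons.IH] Cons.hyps show ?case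
      by (simp add: word_quotient_mult)
  qed
  then show ?thesis
    by (simp add: w(2))
qed

lemma word_quotient_rel:
  assumes "R u v" "u \<in> lists L" "v \<in> lists L"
  shows "word_class L R u = word_class L R v"
  using word_cong.step[of R u v "[]" "[]" L] assms by (simp add: word_class_eq_iff)

lemma free_product_right_hom:
  "(\<lambda>k. word_class (carrier G <+> carrier K) (free_product_rel G K) [Inr k])
    \<in> hom K (free_product G K)" if "group K"
proof (rule homI)
  let ?L = "carrier G <+> carrier K" and ?R = "free_product_rel G K"
  interpret K: group K by fact
  show "word_class ?L ?R [Inr k] \<in> carrier (free_product G K)" if "k \<in> carrier K" for k
    using that by (auto simp: free_product_def word_quotient_def)
  show "word_class ?L ?R [Inr (k \<otimes>\<^bsub>K\<^esub> k')] =
      word_class ?L ?R [Inr k] \<otimes>\<^bsub>free_product G K\<^esub> word_class ?L ?R [Inr k']"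
    if "k \<in> carrier K" "k' \<in> carrier K" for k k'
  proof -
    have "word_class ?L ?R [Inr k, Inr k'] = word_class ?L ?R [Inr (k \<otimes>\<^bsub>K\<^esub> k')]"
      by (rule word_quotient_rel) (use that in \<open>auto intro: free_product_rel.intros\<close>)
    then show ?thesis
      using that by (simp add: free_product_def word_quotient_mult InrI)
  qed
qed

lemma free_group_letter_False:
  assumes "i \<in> X"
  shows "word_class (X \<times> UNIV) free_group_rel [(i, False)] =
    inv\<^bsub>free_group X\<^esub> (word_class (X \<times> UNIV) free_group_rel [(i, True)])"
proof -
  interpret F: group "free_group X" by (rule free_group_group)
  let ?c = "word_class (X \<times> UNIV) free_group_rel"
  have "?c [(i, False), (i, \<not> False)] = ?c []"
    by (rule word_quotient_rel, rule free_group_rel.intros) (use assms in auto)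
  then have "?c [(i, False)] \<otimes>\<^bsub>free_group X\<^esub> ?c [(i, True)] = \<one>\<^bsub>free_group X\<^esub>"
    using assms word_quotient_mult[of "[(i, False)]" "X \<times> UNIV" "[(i, True)]" free_group_rel]
    by (simp add: free_group_def) (simp add: word_quotient_def)
  moreover have "?c [(i, b)] \<in> carrier (free_group X)" for b
    using assms by (auto simp: free_group_def word_quotient_def)
  ultimately show ?thesis
    using F.inv_equality by metis
qed

lemma variable_carrier:
  "i < n \<Longrightarrow> variable G n i \<in> carrier (equation_group G n)"
proof -
  assume "i < n"
  then have "word_class ({..<n} \<times> UNIV) free_group_rel [(i, True)] \<in> carrier (free_group {..<n})"
    by (auto simp: free_group_def word_quotient_def)
  then show ?thesis
    by (auto simp: variable_def equation_group_def free_product_def word_quotient_def)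
qed

lemma coefficient_carrier:
  "g \<in> carrier G \<Longrightarrow> coefficient G n g \<in> carrier (equation_group G n)"
  by (auto simp: coefficient_def equation_group_def free_product_def word_quotient_def)

text \<open>Listing the inverses of the variables among the generators leaves products as the only closure
  step, so no induction hypothesis ever has to be carried through an inverse.\<close>

lemma equation_induct [consumes 2, case_names one coefficient variable inv_variable mult]:
  assumes "group G"
    and w: "w \<in> carrier (equation_group G n)"
    and one: "P \<one>\<^bsub>equation_group G n\<^esub>"
    and coefficient: "\<And>g. g \<in> carrier G \<Longrightarrow> P (coefficient G n g)"
    and var: "\<And>i. i < n \<Longrightarrow> P (variable G n i)"
    and inv_var: "\<And>i. i < n \<Longrightarrow> P (inv\<^bsub>equation_group G n\<^esub> (variable G n i))"
    and mult: "\<And>v w. v \<in> carrier (equation_group G n) \<Longrightarrow> w \<in> carrier (equation_group G n)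
      \<Longrightarrow> P v \<Longrightarrow> P w \<Longrightarrow> P (v \<otimes>\<^bsub>equation_group G n\<^esub> w)"
  shows "P w"
proof -
  let ?E = "equation_group G n" and ?F = "free_group {..<n}"
  let ?L = "carrier G <+> carrier ?F" and ?R = "free_product_rel G ?F"
  let ?\<iota> = "\<lambda>k. word_class ?L ?R [Inr k]"
  interpret F: group ?F by (rule free_group_group)
  interpret E: group ?E by (rule equation_group_group) fact
  have "?\<iota> \<in> hom ?F ?E"
    unfolding equation_group_def by (rule free_product_right_hom) (rule F.is_group)
  then interpret \<iota>: group_hom ?F ?E ?\<iota>
    by unfold_locales
  have P_free: "P (?\<iota> k)" if k: "k \<in> carrier ?F" for k
    using k
  proof (induction rule: word_quotient_induct
      [where L = "{..<n} \<times> UNIV" and R = free_group_rel, folded free_group_def, consumes 1, case_names one letter])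
    case one
    then show ?case
      using \<iota>.hom_one assms(3) by simp
  next
    case (letter l y)
    obtain i b where l: "l = (i, b)" "i < n"
      using letter.hyps(1) by auto
    let ?l = "\<lambda>b. word_class ({..<n} \<times> UNIV) free_group_rel [(i, b)]"
    have l_in: "?l b \<in> carrier ?F" for b
      using l(2) by (auto simp: free_group_def word_quotient_def)
    have y_in: "y \<in> carrier ?F"
      by (rule letter.hyps(2))
    have "P (?\<iota> (?l b))"
    proof (cases b)
      case True
      then show ?thesis
        using var[OF l(2)] by (simp add: variable_def)
    next
      case False
      have "?\<iota> (?l False) = inv\<^bsub>?E\<^esub> ?\<iota> (?l True)"
        using \<iota>.hom_inv[OF l_in[of True]] free_group_letter_False[of i "{..<n}"] l(2) by simp
      then show ?thesis
        using inv_var[OF l(2)] False by (simp add: variable_def)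
    qed
    then have "P (?\<iota> (?l b) \<otimes>\<^bsub>?E\<^esub> ?\<iota> y)"
      by (intro mult \<iota>.hom_closed l_in y_in letter.IH)
    then show ?case
      using \<iota>.hom_mult[OF l_in y_in] by (simp add: l(1))
  qed
  from w show ?thesis
  proof (induction rule: word_quotient_induct
      [where L = ?L and R = ?R, folded free_product_def equation_group_def,
        consumes 1, case_names one letter])
    case one
    then show ?case
      by (rule assms(3))
  next
    case (letter l y)
    from letter.hyps(1) consider g where "l = Inl g" "g \<in> carrier G"
      | k where "l = Inr k" "k \<in> carrier ?F"
      by blast
    then have "P (word_class ?L ?R [l]) \<and> word_class ?L ?R [l] \<in> carrier ?E"
    proof cases
      case (1 g)
      then show ?thesis
        using coefficient[of g] coefficient_carrier[of g G n] by (simp add: coefficient_def)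
    next
      case (2 k)
      then show ?thesis
        using P_free[of k] \<iota>.hom_closed[of k] by simp
    qed
    then show ?case
      using mult[OF _ letter.hyps(2) _ letter.IH] by blast
  qed
qed

context group
begin

lemma substitute_closed:
  assumes "h \<in> tuples G n" "w \<in> carrier (equation_group G n)"
  shows "substitute G h w \<in> carrier G"
  using substitute_hom[OF assms(1)] assms(2) by (auto simp: hom_def)

lemma substitute_mult:
  assumes "h \<in> tuples G n" "v \<in> carrier (equation_group G n)" "w \<in> carrier (equation_group G n)"
  shows "substitute G h (v \<otimes>\<^bsub>equation_group G n\<^esub> w) = substitute G h v \<otimes> substitute G h w"
  using substitute_hom[OF assms(1)] assms(2,3) by (auto simp: hom_def)

lemma substitute_one:
  assumes "h \<in> tuples G n"
  shows "substitute G h \<one>\<^bsub>equation_group G n\<^esub> = \<one>"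
  by (rule hom_one[OF substitute_hom[OF assms]]) (auto intro: equation_group_group is_group)

lemma substitute_inv_variable:
  assumes "h \<in> tuples G n" "i < n"
  shows "substitute G h (inv\<^bsub>equation_group G n\<^esub> (variable G n i)) = inv (h i)"
proof -
  interpret S: group_hom "equation_group G n" G "substitute G h"
    using equation_group_group[OF is_group] substitute_hom[OF assms(1)]
    by (simp add: group_hom_def group_hom_axioms_def is_group)
  show ?thesis
    using S.hom_inv variable_carrier substitute_variable assms by metis
qed

end


section \<open>Coset coordinates\<close>

definition coset_rep :: "'a set \<Rightarrow> 'a" where
  "coset_rep C = (SOME x. x \<in> C)"

definition coset_cocycle :: "('a, 'c) monoid_scheme \<Rightarrow> 'a set \<Rightarrow> 'a \<Rightarrow> 'a" where
  "coset_cocycle G C a = coset_rep C \<otimes>\<^bsub>G\<^esub> a \<otimes>\<^bsub>G\<^esub> inv\<^bsub>G\<^esub> (coset_rep (C #>\<^bsub>G\<^esub> a))"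

text \<open>The coordinates are indexed by pairs of a variable and a coset, which \<open>e\<close> enumerates by the
  numbers below \<open>N\<close>.\<close>

definition coset_coordinates ::
  "('a, 'c) monoid_scheme \<Rightarrow> nat \<Rightarrow> (nat \<Rightarrow> nat \<times> 'a set) \<Rightarrow> (nat \<Rightarrow> 'a) \<Rightarrow> nat \<Rightarrow> 'a" where
  "coset_coordinates G N e h = (\<lambda>j\<in>{..<N}. coset_cocycle G (snd (e j)) (h (fst (e j))))"

context group
begin

lemma coset_rep_in:
  assumes "subgroup H G" "C \<in> rcosets H"
  shows "coset_rep C \<in> C" "coset_rep C \<in> carrier G" "H #> coset_rep C = C"
proof -
  obtain a where a: "a \<in> carrier G" "C = H #> a"
    using assms(2) by (auto simp: RCOSETS_def)
  then have "a \<in> C"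
    using rcos_self assms(1) by blast
  then show C: "coset_rep C \<in> C"
    unfolding coset_rep_def by (rule someI)
  show "coset_rep C \<in> carrier G"
    using C a r_coset_subset_G subgroup.subset[OF assms(1)] by blast
  show "H #> coset_rep C = C"
    using repr_independence[of "coset_rep C" H a] C a assms(1) by simp
qed

lemma rcosets_r_coset:
  assumes "subgroup H G" "C \<in> rcosets H" "a \<in> carrier G"
  shows "C #> a \<in> rcosets H"
proof -
  obtain b where "b \<in> carrier G" "C = H #> b"
    using assms(2) by (auto simp: RCOSETS_def)
  then show ?thesis
    using assms subgroup.subset[OF assms(1)] by (auto simp: coset_mult_assoc RCOSETS_def)
qed

lemma coset_cocycle_in_subgroup:
  assumes "subgroup H G" "C \<in> rcosets H" "a \<in> carrier G"
  shows "coset_cocycle G C a \<in> H"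
proof -
  interpret H: subgroup H G by fact
  note C = coset_rep_in[OF assms(1,2)]
  note Ca = coset_rep_in[OF assms(1) rcosets_r_coset[OF assms]]
  have "C #> a = H #> (coset_rep C \<otimes> a)"
    using coset_mult_assoc[OF H.subset C(2) assms(3)] C(3) by simp
  then have "coset_rep C \<otimes> a \<in> H #> coset_rep (C #> a)"
    using rcos_self[of "coset_rep C \<otimes> a" H] C(2) Ca(3) assms(1,3) by simp
  then obtain k where k: "k \<in> H" "coset_rep C \<otimes> a = k \<otimes> coset_rep (C #> a)"
    by (auto simp: r_coset_def)
  then show ?thesis
    using Ca(2) H.subset by (auto simp: coset_cocycle_def m_assoc subset_iff)
qed

lemma coset_cocycle_shift:
  assumes "subgroup H G" "C \<in> rcosets H" "a \<in> carrier G"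
  shows "coset_rep C \<otimes> a = coset_cocycle G C a \<otimes> coset_rep (C #> a)"
  using coset_rep_in(2)[OF assms(1,2)] coset_rep_in(2)[OF assms(1) rcosets_r_coset[OF assms]] assms(3)
  by (simp add: coset_cocycle_def m_assoc)

lemma coset_coordinates_tuples:
  assumes "subgroup H G" "e ` {..<N} \<subseteq> {..<n} \<times> rcosets H" "h \<in> tuples G n"
  shows "coset_coordinates G N e h \<in> tuples (G\<lparr>carrier := H\<rparr>) N"
proof -
  have "coset_cocycle G (snd (e j)) (h (fst (e j))) \<in> H" if "j < N" for j
  proof -
    have "fst (e j) < n" "snd (e j) \<in> rcosets H"
      using assms(2) that by (auto simp: image_subset_iff mem_Times_iff)
    moreover have "h (fst (e j)) \<in> carrier G"
      using assms(3) \<open>fst (e j) < n\<close> by (auto simp: tuples_def)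
    ultimately show ?thesis
      using coset_cocycle_in_subgroup[OF assms(1)] by blast
  qed
  then show ?thesis
    by (auto simp: coset_coordinates_def tuples_def)
qed

text \<open>Tuples in \<open>T\<close> induce the same permutations of the cosets, so \<open>D\<close> and \<open>u\<close> can be chosen
  uniformly on \<open>T\<close>. For an inverse variable, \<open>t\<^sub>C h\<^sub>i\<^sup>-\<^sup>1 = c(D, h\<^sub>i)\<^sup>-\<^sup>1 t\<^sub>D\<close> where \<open>D = C h\<^sub>i\<^sup>-\<^sup>1\<close>; for a
  product, \<open>t\<^sub>C v(h) w(h) = u(\<phi>(h)) t\<^sub>D w(h) = u(\<phi>(h)) u'(\<phi>(h)) t\<^sub>E\<close>.\<close>

lemma equation_over_subgroup:
  assumes H: "subgroup H G"
    and e: "e ` {..<N} = {..<n} \<times> rcosets H"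
    and T: "T \<subseteq> tuples G n" "T \<noteq> {}"
    and same: "\<And>h h' i C. h \<in> T \<Longrightarrow> h' \<in> T \<Longrightarrow> i < n \<Longrightarrow> C \<in> rcosets H \<Longrightarrow> C #> h i = C #> h' i"
    and w: "w \<in> carrier (equation_group G n)"
    and C: "C \<in> rcosets H"
  shows "\<exists>D\<in>rcosets H. \<exists>u\<in>carrier (equation_group (G\<lparr>carrier := H\<rparr>) N). \<forall>h\<in>T.
    coset_rep C \<otimes> substitute G h w =
      substitute (G\<lparr>carrier := H\<rparr>) (coset_coordinates G N e h) u \<otimes> coset_rep D"
proof -
  let ?K = "G\<lparr>carrier := H\<rparr>" and ?\<phi> = "coset_coordinates G N e"
  let ?EK = "equation_group ?K N"
  interpret H: subgroup H G by fact
  interpret K: group ?K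
    by (rule subgroup_imp_group) fact
  interpret EK: group ?EK
    by (rule equation_group_group) (rule K.is_group)
  have \<phi>: "?\<phi> h \<in> tuples ?K N" if "h \<in> T" for h
    using coset_coordinates_tuples[OF H] e T(1) that by blast
  have sub_H: "substitute ?K (?\<phi> h) u \<in> H" if "h \<in> T" "u \<in> carrier ?EK" for h u
    using K.substitute_closed[OF \<phi>] that by simp
  have entry: "h i \<in> carrier G" if "h \<in> T" "i < n" for h i
    using T(1) that by (auto simp: tuples_def)
  obtain h0 where h0: "h0 \<in> T"
    using T(2) by blast
  have index: "\<exists>j<N. \<forall>h. ?\<phi> h j = coset_cocycle G D (h i)" if iD: "i < n" "D \<in> rcosets H" for i D
  proof -
    have "(i, D) \<in> e ` {..<N}"
      using e iD by blast
    then obtain j where "j < N" "e j = (i, D)"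
      by auto
    then show ?thesis
      by (auto simp: coset_coordinates_def)
  qed
  from is_group w have "\<forall>C\<in>rcosets H. \<exists>D\<in>rcosets H. \<exists>u\<in>carrier ?EK. \<forall>h\<in>T.
    coset_rep C \<otimes> substitute G h w = substitute ?K (?\<phi> h) u \<otimes> coset_rep D"
  proof (induction rule: equation_induct)
    case one
    show ?case
    proof
      fix C assume C: "C \<in> rcosets H"
      have "\<forall>h\<in>T. coset_rep C \<otimes> substitute G h \<one>\<^bsub>equation_group G n\<^esub> =
          substitute ?K (?\<phi> h) \<one>\<^bsub>?EK\<^esub> \<otimes> coset_rep C"
        using T(1) coset_rep_in(2)[OF H C] K.substitute_one[OF \<phi>] substitute_one[of _ n]
        by (simp add: subset_iff)
      then show "\<exists>D\<in>rcosets H. \<exists>u\<in>carrier ?EK. \<forall>h\<in>T.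
          coset_rep C \<otimes> substitute G h \<one>\<^bsub>equation_group G n\<^esub> =
          substitute ?K (?\<phi> h) u \<otimes> coset_rep D"
        using C EK.one_closed by blast
    qed
  next
    case (coefficient a)
    show ?case
    proof
      fix C assume C: "C \<in> rcosets H"
      let ?u = "coefficient ?K N (coset_cocycle G C a)"
      have c: "coset_cocycle G C a \<in> carrier ?K"
        using coset_cocycle_in_subgroup[OF H C coefficient] by simp
      have "\<forall>h\<in>T. coset_rep C \<otimes> substitute G h (coefficient G n a) =
          substitute ?K (?\<phi> h) ?u \<otimes> coset_rep (C #> a)"
      proof
        fix h assume h: "h \<in> T"
        have "substitute G h (coefficient G n a) = a"
          using substitute_coefficient T(1) h coefficient by blast
        then show "coset_rep C \<otimes> substitute G h (coefficient G n a) =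
          substitute ?K (?\<phi> h) ?u \<otimes> coset_rep (C #> a)"
          using K.substitute_coefficient[OF \<phi>[OF h] c] coset_cocycle_shift[OF H C coefficient]
          by simp
      qed
      then show "\<exists>D\<in>rcosets H. \<exists>u\<in>carrier ?EK. \<forall>h\<in>T.
          coset_rep C \<otimes> substitute G h (coefficient G n a) =
          substitute ?K (?\<phi> h) u \<otimes> coset_rep D"
        using rcosets_r_coset[OF H C coefficient] coefficient_carrier[OF c] by blast
    qed
  next
    case (variable i)
    show ?case
    proof
      fix C assume C: "C \<in> rcosets H"
      obtain j where j: "j < N" "\<And>h. ?\<phi> h j = coset_cocycle G C (h i)"
        using index[OF variable C] by blast
      have "\<forall>h\<in>T. coset_rep C \<otimes> substitute G h (variable G n i) =
          substitute ?K (?\<phi> h) (variable ?K N j) \<otimes> coset_rep (C #> h0 i)"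
      proof
        fix h assume h: "h \<in> T"
        have "substitute G h (variable G n i) = h i"
          using substitute_variable T(1) h variable by blast
        moreover have "coset_rep C \<otimes> h i = coset_cocycle G C (h i) \<otimes> coset_rep (C #> h0 i)"
          using coset_cocycle_shift[OF H C entry[OF h variable]] same[OF h h0 variable C] by simp
        ultimately show "coset_rep C \<otimes> substitute G h (variable G n i) =
          substitute ?K (?\<phi> h) (variable ?K N j) \<otimes> coset_rep (C #> h0 i)"
          using K.substitute_variable[OF \<phi>[OF h] j(1)] j(2) by simp
      qed
      then show "\<exists>D\<in>rcosets H. \<exists>u\<in>carrier ?EK. \<forall>h\<in>T.
          coset_rep C \<otimes> substitute G h (variable G n i) =
          substitute ?K (?\<phi> h) u \<otimes> coset_rep D"
        using rcosets_r_coset[OF H C entry[OF h0 variable]] variable_carrier[OF j(1)] by blast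
    qed
  next
    case (inv_variable i)
    show ?case
    proof
      fix C assume C: "C \<in> rcosets H"
      define D where "D = C #> inv (h0 i)"
      have h0i: "h0 i \<in> carrier G"
        by (rule entry) fact+
      have D: "D \<in> rcosets H"
        unfolding D_def by (rule rcosets_r_coset[OF H C]) (use h0i in simp)
      have C_sub: "C \<subseteq> carrier G"
        using C subgroup.rcosets_carrier[OF H is_group] by blast
      have D_C: "D #> h i = C" if "h \<in> T" for h
        using same[OF that h0 inv_variable D] coset_mult_assoc[OF C_sub, of "inv (h0 i)" "h0 i"]
          coset_mult_one[OF C_sub] h0i by (simp add: D_def)
      obtain j where j: "j < N" "\<And>h. ?\<phi> h j = coset_cocycle G D (h i)"
        using index[OF inv_variable D] by blast
      let ?u = "inv\<^bsub>?EK\<^esub> (variable ?K N j)"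
      have "\<forall>h\<in>T. coset_rep C \<otimes> substitute G h (inv\<^bsub>equation_group G n\<^esub> (variable G n i)) =
          substitute ?K (?\<phi> h) ?u \<otimes> coset_rep D"
      proof
        fix h assume h: "h \<in> T"
        let ?c = "coset_cocycle G D (h i)"
        have hi: "h i \<in> carrier G"
          by (rule entry) fact+
        have c_H: "?c \<in> H"
          by (rule coset_cocycle_in_subgroup[OF H D hi])
        have c: "?c \<in> carrier G"
          using c_H by simp
        have "coset_rep D \<otimes> h i = ?c \<otimes> coset_rep C"
          using coset_cocycle_shift[OF H D hi] D_C[OF h] by simp
        then have "coset_rep C = inv ?c \<otimes> (coset_rep D \<otimes> h i)"
          using c coset_rep_in(2)[OF H C] by (simp add: m_assoc[symmetric])
        then have "coset_rep C \<otimes> inv (h i) = inv ?c \<otimes> coset_rep D"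
          using c coset_rep_in(2)[OF H D] hi by (simp add: m_assoc)
        moreover have "substitute ?K (?\<phi> h) ?u = inv ?c"
          using K.substitute_inv_variable[OF \<phi>[OF h] j(1)] j(2)
            m_inv_consistent[OF H c_H] by simp
        moreover have "substitute G h (inv\<^bsub>equation_group G n\<^esub> (variable G n i)) = inv (h i)"
          using substitute_inv_variable T(1) h inv_variable by blast
        ultimately show "coset_rep C \<otimes>
            substitute G h (inv\<^bsub>equation_group G n\<^esub> (variable G n i)) =
          substitute ?K (?\<phi> h) ?u \<otimes> coset_rep D"
          by simp
      qed
      then show "\<exists>D\<in>rcosets H. \<exists>u\<in>carrier ?EK. \<forall>h\<in>T.
          coset_rep C \<otimes> substitute G h (inv\<^bsub>equation_group G n\<^esub> (variable G n i)) =
          substitute ?K (?\<phi> h) u \<otimes> coset_rep D"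
        using D EK.inv_closed[OF variable_carrier[OF j(1)]] by blast
    qed
  next
    case (mult v w)
    show ?case
    proof
      fix C assume C: "C \<in> rcosets H"
      obtain D u where D: "D \<in> rcosets H" and u: "u \<in> carrier ?EK"
        and eq: "\<And>h. h \<in> T \<Longrightarrow>
          coset_rep C \<otimes> substitute G h v = substitute ?K (?\<phi> h) u \<otimes> coset_rep D"
        using mult.IH(1) C by blast
      obtain E u' where E: "E \<in> rcosets H" and u': "u' \<in> carrier ?EK"
        and eq': "\<And>h. h \<in> T \<Longrightarrow>
          coset_rep D \<otimes> substitute G h w = substitute ?K (?\<phi> h) u' \<otimes> coset_rep E"
        using mult.IH(2) D by blast
      have "\<forall>h\<in>T. coset_rep C \<otimes> substitute G h (v \<otimes>\<^bsub>equation_group G n\<^esub> w) =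
          substitute ?K (?\<phi> h) (u \<otimes>\<^bsub>?EK\<^esub> u') \<otimes> coset_rep E"
      proof
        fix h assume h: "h \<in> T"
        then have hn: "h \<in> tuples G n"
          using T(1) by blast
        let ?s = "substitute ?K (?\<phi> h)"
        have cl: "substitute G h v \<in> carrier G" "substitute G h w \<in> carrier G"
            "?s u \<in> carrier G" "?s u' \<in> carrier G"
          using substitute_closed[OF hn] mult.hyps sub_H[OF h] u u' by auto
        note reps = coset_rep_in(2)[OF H C] coset_rep_in(2)[OF H D] coset_rep_in(2)[OF H E]
        have "coset_rep C \<otimes> substitute G h (v \<otimes>\<^bsub>equation_group G n\<^esub> w) =
            (coset_rep C \<otimes> substitute G h v) \<otimes> substitute G h w"
          using substitute_mult[OF hn] mult.hyps cl reps by (simp add: m_assoc)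
        also have "\<dots> = ?s u \<otimes> (coset_rep D \<otimes> substitute G h w)"
          using eq[OF h] cl reps by (simp add: m_assoc)
        also have "\<dots> = (?s u \<otimes> ?s u') \<otimes> coset_rep E"
          using eq'[OF h] cl reps by (simp add: m_assoc)
        also have "?s u \<otimes> ?s u' = ?s (u \<otimes>\<^bsub>?EK\<^esub> u')"
          using K.substitute_mult[OF \<phi>[OF h] u u'] by simp
        finally show "coset_rep C \<otimes> substitute G h (v \<otimes>\<^bsub>equation_group G n\<^esub> w) =
          ?s (u \<otimes>\<^bsub>?EK\<^esub> u') \<otimes> coset_rep E" .
      qed
      then show "\<exists>D\<in>rcosets H. \<exists>u\<in>carrier ?EK. \<forall>h\<in>T.
          coset_rep C \<otimes> substitute G h (v \<otimes>\<^bsub>equation_group G n\<^esub> w) =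
          substitute ?K (?\<phi> h) u \<otimes> coset_rep D"
        using E EK.m_closed[OF u u'] by blast
    qed
  qed
  then show ?thesis
    using C by blast
qed

text \<open>The equation over \<open>H\<close> that corresponds to \<open>w\<close> at the coset \<open>H\<close> itself detects whether
  \<open>w(h) = 1\<close>, provided that \<open>w(h)\<close> fixes this coset. One point of \<open>S\<close> where \<open>w\<close> vanishes
  ensures the proviso on all of \<open>T\<close>.\<close>

lemma vanishing_transfer:
  assumes H: "subgroup H G"
    and e: "e ` {..<N} = {..<n} \<times> rcosets H"
    and T: "T \<subseteq> tuples G n"
    and same: "\<And>h h' i C. h \<in> T \<Longrightarrow> h' \<in> T \<Longrightarrow> i < n \<Longrightarrow> C \<in> rcosets H \<Longrightarrow> C #> h i = C #> h' i"
    and S: "S \<subseteq> T" "S \<noteq> {}"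
    and sub: "vanishing_equations (G\<lparr>carrier := H\<rparr>) N (coset_coordinates G N e ` S)
      \<subseteq> vanishing_equations (G\<lparr>carrier := H\<rparr>) N (coset_coordinates G N e ` T)"
  shows "vanishing_equations G n S \<subseteq> vanishing_equations G n T"
proof
  fix w assume w: "w \<in> vanishing_equations G n S"
  let ?K = "G\<lparr>carrier := H\<rparr>" and ?\<phi> = "coset_coordinates G N e"
  interpret H: subgroup H G by fact
  interpret K: group ?K
    by (rule subgroup_imp_group) fact
  have w_in: "w \<in> carrier (equation_group G n)" and w_S: "\<And>h. h \<in> S \<Longrightarrow> substitute G h w = \<one>"
    using w by (auto simp: vanishing_equations_def)
  have C: "H \<in> rcosets H"
    by (rule H.subgroup_in_rcosets) (rule is_group)
  have "T \<noteq> {}"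
    using S by blast
  with same have "\<exists>D\<in>rcosets H. \<exists>u\<in>carrier (equation_group ?K N). \<forall>h\<in>T.
      coset_rep H \<otimes> substitute G h w = substitute ?K (?\<phi> h) u \<otimes> coset_rep D"
    by (intro equation_over_subgroup[OF H e T _ _ w_in C])
  then obtain D u where D: "D \<in> rcosets H" and u: "u \<in> carrier (equation_group ?K N)"
    and eq: "\<And>h. h \<in> T \<Longrightarrow>
      coset_rep H \<otimes> substitute G h w = substitute ?K (?\<phi> h) u \<otimes> coset_rep D"
    by blast
  note reps = coset_rep_in(2)[OF H C] coset_rep_in(2)[OF H D]
  have u_H: "substitute ?K (?\<phi> h) u \<in> H" if "h \<in> T" for h
    using K.substitute_closed[OF coset_coordinates_tuples[OF H, of e N n h] u] e T that by auto
  have "D = H"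
  proof -
    obtain h where h: "h \<in> S"
      using S(2) by blast
    then have "coset_rep H = substitute ?K (?\<phi> h) u \<otimes> coset_rep D"
      using eq[of h] w_S[OF h] S(1) reps by auto
    then have "coset_rep H \<in> H #> coset_rep D"
      using u_H[of h] h S(1) by (auto simp: r_coset_def)
    then have "H #> coset_rep D = H #> coset_rep H"
      using repr_independence[OF _ reps(2) H] by blast
    then show ?thesis
      using coset_rep_in(3)[OF H C] coset_rep_in(3)[OF H D] by simp
  qed
  have detect: "substitute G h w = \<one> \<longleftrightarrow> substitute ?K (?\<phi> h) u = \<one>" if "h \<in> T" for h
  proof -
    have "substitute G h w \<in> carrier G" "substitute ?K (?\<phi> h) u \<in> carrier G"
      using substitute_closed[OF _ w_in] T u_H that by auto
    moreover have "coset_rep H \<otimes> substitute G h w = substitute ?K (?\<phi> h) u \<otimes> coset_rep H"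
      using eq[OF that] \<open>D = H\<close> by simp
    ultimately show ?thesis
      using reps(1) by (metis l_one r_one l_cancel_one' r_cancel_one')
  qed
  have "u \<in> vanishing_equations ?K N (?\<phi> ` S)"
    using u detect w_S S(1) by (auto simp: vanishing_equations_def)
  then have "u \<in> vanishing_equations ?K N (?\<phi> ` T)"
    using sub by blast
  then show "w \<in> vanishing_equations G n T"
    using w_in detect by (auto simp: vanishing_equations_def)
qed

end


section \<open>Passing to the group from a subgroup of finite index\<close>

theorem theorem2:
  fixes A :: "('a, 'b) monoid_scheme" and H :: "'a set"
  assumes "group A"
    and "subgroup H A"
    and "finite (rcosets\<^bsub>A\<^esub> H)"
    and "equationally_Artinian (A\<lparr>carrier := H\<rparr>)"
  shows "equationally_Artinian A"
  unfolding equationally_Artinian_iff_vanishing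
proof (intro allI impI)
  interpret group A by fact
  let ?K = "A\<lparr>carrier := H\<rparr>" and ?Q = "rcosets\<^bsub>A\<^esub> H"
  fix n and X :: "nat \<Rightarrow> (nat \<Rightarrow> 'a) set"
  assume X: "\<forall>i. X i \<subseteq> tuples A n" and asc: "\<forall>i. X i \<subseteq> X (Suc i)"
  have mono: "X i \<subseteq> X j" if "i \<le> j" for i j
    using asc that by (simp add: lift_Suc_mono_le)
  obtain e where "bij_betw e {0..<card ({..<n} \<times> ?Q)} ({..<n} \<times> ?Q)"
    using ex_bij_betw_nat_finite[of "{..<n} \<times> ?Q"] assms(3) by auto
  then obtain N where e: "e ` {..<N} = {..<n} \<times> ?Q"
    by (auto simp: bij_betw_def atLeast0LessThan)
  let ?\<phi> = "coset_coordinates A N e"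
  \<comment> \<open>Restriction to \<open>n\<close> indices and to actual cosets leaves only finitely many possible actions.\<close>
  define action where "action h = (\<lambda>i\<in>{..<n}. \<lambda>C\<in>?Q. C #>\<^bsub>A\<^esub> h i)" for h :: "nat \<Rightarrow> 'a"
  define piece where "piece p i = {h \<in> X i. action h = p}" for p i
  let ?\<Pi> = "{..<n} \<rightarrow>\<^sub>E (?Q \<rightarrow>\<^sub>E ?Q)"
  have fin: "finite ?\<Pi>"
    by (intro finite_PiE finite_lessThan assms(3))
  have action: "action h \<in> ?\<Pi>" if "h \<in> X i" for h i
  proof -
    have "h k \<in> carrier A" if "k < n" for k
      using X \<open>h \<in> X i\<close> that by (auto simp: tuples_def)
    then show ?thesis
      using rcosets_r_coset[OF assms(2)] by (simp add: action_def PiE_def Pi_def)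
  qed
  have piece_mono: "piece p i \<subseteq> piece p j" if "i \<le> j" for p i j
    using mono[OF that] by (auto simp: piece_def)
  have "\<exists>m. \<forall>i\<ge>m. vanishing_equations A n (piece p m) \<subseteq> vanishing_equations A n (piece p i)" for p
  proof (cases "\<exists>m. piece p m \<noteq> {}")
    case False
    then show ?thesis
      by auto
  next
    case True
    then obtain l where l: "piece p l \<noteq> {}" ..
    have "\<forall>i. ?\<phi> ` piece p i \<subseteq> tuples ?K N"
    proof (intro allI image_subsetI)
      fix i h assume "h \<in> piece p i"
      then have "h \<in> tuples A n"
        using X by (auto simp: piece_def)
      then show "?\<phi> h \<in> tuples ?K N"
        by (intro coset_coordinates_tuples[OF assms(2)]) (use e in auto)
    qed
    moreover have "\<forall>i. ?\<phi> ` piece p i \<subseteq> ?\<phi> ` piece p (Suc i)"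
      using piece_mono by (simp add: image_mono)
    ultimately obtain m where
      m: "\<And>i. i \<ge> m \<Longrightarrow> vanishing_equations ?K N (?\<phi> ` piece p i) =
        vanishing_equations ?K N (?\<phi> ` piece p m)"
      using assms(4)[unfolded equationally_Artinian_iff_vanishing,
          THEN spec[of _ N], THEN spec[of _ "\<lambda>i. ?\<phi> ` piece p i"]] by blast
    \<comment> \<open>Beyond \<open>l\<close> the piece contains a point, which is what fixes the coset \<open>D\<close> when an equation
      over \<open>A\<close> is translated.\<close>
    have "vanishing_equations A n (piece p (max l m)) \<subseteq> vanishing_equations A n (piece p i)"
      if i: "i \<ge> max l m" for i
    proof (rule vanishing_transfer[OF assms(2) e])
      show "piece p i \<subseteq> tuples A n"
        using X by (auto simp: piece_def)
      show "piece p (max l m) \<subseteq> piece p i"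
        by (rule piece_mono[OF i])
      show "piece p (max l m) \<noteq> {}"
        using l piece_mono[of l "max l m" p] by auto
      show "vanishing_equations ?K N (?\<phi> ` piece p (max l m))
          \<subseteq> vanishing_equations ?K N (?\<phi> ` piece p i)"
        using m[of "max l m"] m[of i] i by simp
      show "C #>\<^bsub>A\<^esub> h k = C #>\<^bsub>A\<^esub> h' k"
        if "h \<in> piece p i" "h' \<in> piece p i" "k < n" "C \<in> ?Q" for h h' k C
      proof -
        have "action h k C = action h' k C"
          using that by (simp add: piece_def)
        then show ?thesis
          using that by (simp add: action_def)
      qed
    qed
    then show ?thesis
      by blast
  qed
  then obtain M where M: "\<And>p i. i \<ge> M p \<Longrightarrow>
      vanishing_equations A n (piece p (M p)) \<subseteq> vanishing_equations A n (piece p i)"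
    by metis
  obtain m where m: "\<And>p. p \<in> ?\<Pi> \<Longrightarrow> M p \<le> m"
    using finite_nat_set_iff_bounded_le[of "M ` ?\<Pi>"] fin by auto
  have "vanishing_equations A n (X i) = vanishing_equations A n (X m)" if i: "i \<ge> m" for i
  proof
    show "vanishing_equations A n (X i) \<subseteq> vanishing_equations A n (X m)"
      by (rule vanishing_equations_antimono[OF mono[OF i]])
    show "vanishing_equations A n (X m) \<subseteq> vanishing_equations A n (X i)"
    proof
      fix w assume w: "w \<in> vanishing_equations A n (X m)"
      have "substitute A h w = \<one>\<^bsub>A\<^esub>" if h: "h \<in> X i" for h
      proof -
        let ?p = "action h"
        have p: "M ?p \<le> m"
          by (rule m[OF action[OF h]])
        have "piece ?p (M ?p) \<subseteq> X m"
          using mono[OF p] by (auto simp: piece_def)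
        then have "w \<in> vanishing_equations A n (piece ?p (M ?p))"
          using w vanishing_equations_antimono by blast
        then have "w \<in> vanishing_equations A n (piece ?p i)"
          using M[of ?p i] p i by auto
        then show ?thesis
          using h by (simp add: vanishing_equations_def piece_def)
      qed
      then show "w \<in> vanishing_equations A n (X i)"
        using w by (simp add: vanishing_equations_def)
    qed
  qed
  then show "\<exists>m. \<forall>i\<ge>m. vanishing_equations A n (X i) = vanishing_equations A n (X m)"
    by blast
qed

end
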